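(* Let $K$ be a finite set, let $k(x,y)\ge 0$ ($x\ne y\in K$) be the transition rates of an irreducible Markov jump process on $K$ with backward generator $L$ and unique stationary distribution $\rho^s$, and let $f:K\to\mathbb{R}$ satisfy $\sum_{x}\rho^s(x)f(x)=0$. Then the unique function $V:K\to\mathbb{R}$ satisfying $LV(x)+f(x)=0$ for all $x\in K$ and $\sum_x\rho^s(x)V(x)=0$ is given by $$V(x)=\sum_{y\in K}\frac{w(x\to y)}{W}\,f(y),\qquad x\in K,$$ where $w(x\to y)$ is the total weight of rooted spanning two-tree forests in which $x$ lies in the tree rooted at $y$, and $W$ is the total weight of all rooted spanning trees.
   Context: The backward generator acts on functions $h:K\to\mathbb{R}$ by $Lh(x)=\sum_y k(x,y)[h(y)-h(x)]$. The associated digraph $G$ has vertex set $K$ and an arc $(x,y)$, $x\neq y$, whenever $k(x,y)>0$; irreducibility means that $G$ is strongly connected. The stationary distribution $\rho^s>0$ is the unique probability distribution on $K$ with $\rho^sL=0$. A rooted tree is a tree formed by arcs of $G$, all oriented toward a distinguished vertex, its root (every non-root vertex has exactly one outgoing arc in the tree, the root has none); a single vertex counts as a tree. The weight of a collection of arcs (tree or forest) is the product of $k(u,u')$ over its arcs $(u,u')$ (empty product $=1$), and the weight of a set of trees or forests is the sum of the weights of its elements. $\mathcal{T}_x$ is the set of all spanning trees rooted at $x$, $w(x)=\sum_{T\in\mathcal{T}_x}\prod_{(u,u')\in T}k(u,u')$, and $W=\sum_{y\in K}w(y)$. $\mathcal{F}^{x\to y}$ is the set of all rooted spanning forests consisting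 of exactly two (vertex-disjoint) rooted trees such that $x$ and $y$ are in the same tree and that tree is rooted at $y$, while the second tree is rooted at any of its vertices (different choices of root give different forests). The case $x=y$ is allowed. $w(x\to y)=\sum_{F\in\mathcal{F}^{x\to y}}\prod_{(u,u')\in F}k(u,u')$. *)

theory Defs
  imports Complex_Main "Graph_Theory.Graph_Theory"
begin

section \<open>Markov jump processes on a finite set\<close>

text \<open>
  States form a set \<open>K\<close>; \<open>k x y\<close> is the rate of the jump from \<open>x\<close> to \<open>y\<close>. Only off-diagonal rates
  between elements of \<open>K\<close> matter: the diagonal cancels in the generator and is excluded from the
  digraph.
\<close>

definition generator :: "'a set \<Rightarrow> ('a \<Rightarrow> 'a \<Rightarrow> real) \<Rightarrow> ('a \<Rightarrow> real) \<Rightarrow> 'a \<Rightarrow> real" where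
  "generator K k h x = (\<Sum>y\<in>K. k x y * (h y - h x))"

definition rate_digraph :: "'a set \<Rightarrow> ('a \<Rightarrow> 'a \<Rightarrow> real) \<Rightarrow> ('a, 'a \<times> 'a) pre_digraph" where
  "rate_digraph K k =
     \<lparr> verts = K, arcs = {(x, y). x \<in> K \<and> y \<in> K \<and> x \<noteq> y \<and> k x y > 0}, tail = fst, head = snd \<rparr>"

definition irreducible_rates :: "'a set \<Rightarrow> ('a \<Rightarrow> 'a \<Rightarrow> real) \<Rightarrow> bool" where
  "irreducible_rates K k \<longleftrightarrow> strongly_connected (rate_digraph K k)"

text \<open>
  The last conjunct is \<open>\<rho>L = 0\<close>, with the row vector \<open>\<rho>L\<close> read as the functional
  \<open>h \<mapsto> \<rho>(Lh)\<close>. For irreducible rates there is exactly one such \<open>\<rho>\<close> on \<open>K\<close>, and it is positive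
  there.
\<close>

definition stationary_distribution ::
  "'a set \<Rightarrow> ('a \<Rightarrow> 'a \<Rightarrow> real) \<Rightarrow> ('a \<Rightarrow> real) \<Rightarrow> bool" where
  "stationary_distribution K k \<rho> \<longleftrightarrow>
     (\<forall>x\<in>K. 0 \<le> \<rho> x) \<and> (\<Sum>x\<in>K. \<rho> x) = 1 \<and>
     (\<forall>h. (\<Sum>x\<in>K. \<rho> x * generator K k h x) = 0)"


section \<open>Rooted trees and forests\<close>

text \<open>
  The library predicate \<^const>\<open>tree\<close> asks for weak connectedness and the absence of directed cycles.
  Under the out-degree conditions below it describes trees in the undirected sense, as
  \<open>rooted_tree_card_arcs\<close> confirms.
\<close>

definition rooted_tree :: "('a, 'b) pre_digraph \<Rightarrow> 'a \<Rightarrow> ('a, 'b) pre_digraph \<Rightarrow> bool" where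
  "rooted_tree G r T \<longleftrightarrow>
     subgraph T G \<and> tree T \<and> r \<in> verts T \<and> out_arcs T r = {} \<and>
     (\<forall>v\<in>verts T - {r}. out_degree T v = 1)"

lemma rooted_tree_card_arcs:
  assumes "rooted_tree G r T" "finite (verts T)" "finite (arcs T)"
  shows "card (arcs T) + 1 = card (verts T)"
proof -
  interpret T: wf_digraph T
    using assms(1) by (auto simp: rooted_tree_def subgraph_def)
  have "arcs T = (\<Union>v\<in>verts T. out_arcs T v)"
    by (auto simp: out_arcs_def)
  then have "card (arcs T) = (\<Sum>v\<in>verts T. card (out_arcs T v))"
    using assms(2,3) by (simp only:) (subst card_UN_disjoint, auto simp: out_arcs_def)
  also have "\<dots> = (\<Sum>v\<in>verts T - {r}. 1)"
    using assms(1,2) by (intro sum.mono_neutral_cong_right)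
      (auto simp: rooted_tree_def out_degree_def)
  also have "\<dots> + 1 = card (verts T)"
    using assms(1,2) card.remove[of "verts T" r] by (simp add: rooted_tree_def)
  finally show ?thesis by simp
qed

definition spanning_trees_at :: "('a, 'b) pre_digraph \<Rightarrow> 'a \<Rightarrow> ('a, 'b) pre_digraph set" where
  "spanning_trees_at G x = {T. rooted_tree G x T \<and> spanning T G}"

text \<open>
  A forest is represented by the union of its two trees. This loses nothing: the trees are the
  weakly connected components of the union, and their roots are its two vertices without outgoing
  arc, so different choices of roots give different arc sets.
\<close>

definition two_tree_forests ::
  "('a, 'b) pre_digraph \<Rightarrow> 'a \<Rightarrow> 'a \<Rightarrow> ('a, 'b) pre_digraph set" where
  "two_tree_forests G x y =
     {F. \<exists>T\<^sub>1 T\<^sub>2 z. F = union T\<^sub>1 T\<^sub>2 \<and> rooted_tree G y T\<^sub>1 \<and> rooted_tree G z T\<^sub>2 \<and>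
        verts T\<^sub>1 \<inter> verts T\<^sub>2 = {} \<and> spanning F G \<and> x \<in> verts T\<^sub>1}"


section \<open>Weights\<close>

definition arc_weight :: "('a \<Rightarrow> 'a \<Rightarrow> real) \<Rightarrow> ('a, 'a \<times> 'a) pre_digraph \<Rightarrow> real" where
  "arc_weight k H = (\<Prod>(u, v)\<in>arcs H. k u v)"

definition tree_weight :: "'a set \<Rightarrow> ('a \<Rightarrow> 'a \<Rightarrow> real) \<Rightarrow> 'a \<Rightarrow> real" where
  "tree_weight K k x = (\<Sum>T\<in>spanning_trees_at (rate_digraph K k) x. arc_weight k T)"

definition total_tree_weight :: "'a set \<Rightarrow> ('a \<Rightarrow> 'a \<Rightarrow> real) \<Rightarrow> real" where
  "total_tree_weight K k = (\<Sum>y\<in>K. tree_weight K k y)"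

definition forest_weight :: "'a set \<Rightarrow> ('a \<Rightarrow> 'a \<Rightarrow> real) \<Rightarrow> 'a \<Rightarrow> 'a \<Rightarrow> real" where
  "forest_weight K k x y = (\<Sum>F\<in>two_tree_forests (rate_digraph K k) x y. arc_weight k F)"


section \<open>The Poisson equation\<close>

definition centered_poisson_solution ::
  "'a set \<Rightarrow> ('a \<Rightarrow> 'a \<Rightarrow> real) \<Rightarrow> ('a \<Rightarrow> real) \<Rightarrow> ('a \<Rightarrow> real) \<Rightarrow> ('a \<Rightarrow> real) \<Rightarrow> bool" where
  "centered_poisson_solution K k \<rho> f V \<longleftrightarrow>
     (\<forall>x\<in>K. generator K k V x + f x = 0) \<and> (\<Sum>x\<in>K. \<rho> x * V x) = 0"

end

theory Submission
  imports Defs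
begin

text \<open>
  Let \<open>N\<^sub>j x y\<close> be the weight of the spanning forests with \<open>j\<close> roots in which \<open>x\<close> lies in the tree rooted
  at \<open>y\<close>, and let \<open>W\<^sub>j\<close> be the weight of all spanning forests with \<open>j\<close> roots. Everything rests on one
  identity, \<open>forest_sum_backward\<close>,
  \<open>L N\<^sub>j\<^sub>+\<^sub>1 = N\<^sub>j - W\<^sub>j I\<close>,
  which is proved by adding, removing and exchanging the arc that leaves a vertex. The theorem
  concerns \<open>N\<^sub>2\<close>, the matrix of the forest weights, and \<open>W\<^sub>1 = W\<close>.

  Multiplying the identity from the left by the stationary distribution makes its left-hand side
  vanish and gives \<open>\<rho> N\<^sub>j = W\<^sub>j \<rho>\<close> for every \<open>j\<close>. For \<open>j = 1\<close> this is the Markov chain tree theorem: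
  \<open>N\<^sub>1 x y\<close> is the weight \<open>w y\<close> of the spanning trees rooted at \<open>y\<close>, whatever \<open>x\<close> is, hence
  \<open>w y = W \<rho> y\<close>. The identity for \<open>j = 1\<close> then reads \<open>L N\<^sub>2 = W (1 \<rho> - I)\<close>, and applied to a function \<open>f\<close>
  with \<open>\<rho> f = 0\<close> it says that \<open>V = N\<^sub>2 f / W\<close> solves \<open>L V = - f\<close>. For \<open>j = 2\<close> it gives
  \<open>\<rho> V = W\<^sub>2 \<rho> f / W = 0\<close>, so this solution is centred. That \<open>W > 0\<close> follows from the existence of a
  spanning tree, and two centred solutions agree because their difference is harmonic, hence constant
  by the maximum principle (\<open>harmonic_constant\<close>).

  The identity is proved for forests given as sets of arcs, that is, as acyclic single-valued
  relations. The lemmas \<open>spanning_trees_at_rate_digraph\<close> and \<open>two_tree_forests_rate_digraph\<close> identify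
  these, for one and two roots, with the digraphs that define the tree and forest weights.
\<close>

section \<open>Rooted forests as arc sets\<close>

text \<open>
  The parameter \<open>j\<close> is the number of roots: in a forest of this kind a vertex is a root or has exactly
  one outgoing arc, see \<open>card_forest_roots\<close>. The equation is written additively, so that there are no
  forests when \<open>j\<close> exceeds the number of vertices; this covers \<open>j = 2\<close> on a one-point set.
\<close>

definition rooted_forests :: "'a set \<Rightarrow> 'a rel \<Rightarrow> nat \<Rightarrow> 'a rel set" where
  "rooted_forests K A j =
     {F. F \<subseteq> A \<and> single_valued F \<and> acyclic F \<and> card F + j = card K}"

definition leads_to_root :: "'a rel \<Rightarrow> 'a \<Rightarrow> 'a \<Rightarrow> bool" where
  "leads_to_root F x y \<longleftrightarrow> (x, y) \<in> F\<^sup>* \<and> y \<notin> Domain F"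

definition rel_weight :: "('a \<Rightarrow> 'a \<Rightarrow> real) \<Rightarrow> 'a rel \<Rightarrow> real" where
  "rel_weight k F = (\<Prod>(u, v)\<in>F. k u v)"

definition total_forest_sum ::
  "'a set \<Rightarrow> 'a rel \<Rightarrow> ('a \<Rightarrow> 'a \<Rightarrow> real) \<Rightarrow> nat \<Rightarrow> real" where
  "total_forest_sum K A k j = (\<Sum>F\<in>rooted_forests K A j. rel_weight k F)"

definition forest_sum ::
  "'a set \<Rightarrow> 'a rel \<Rightarrow> ('a \<Rightarrow> 'a \<Rightarrow> real) \<Rightarrow> nat \<Rightarrow> 'a \<Rightarrow> 'a \<Rightarrow> real" where
  "forest_sum K A k j x y =
     (\<Sum>F\<in>rooted_forests K A j. rel_weight k F * of_bool (leads_to_root F x y))"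

lemma finite_rooted_forests: "finite A \<Longrightarrow> finite (rooted_forests K A j)"
  by (rule finite_subset[of _ "Pow A"]) (auto simp: rooted_forests_def)

lemma leads_to_root_unique:
  assumes "single_valued F" "leads_to_root F u y" "leads_to_root F u z"
  shows "y = z"
  using single_valued_confluent[OF assms(1), of u y z] assms(2,3)
  by (auto simp: leads_to_root_def Not_Domain_rtrancl)

lemma leads_to_root_at_root: "x \<notin> Domain F \<Longrightarrow> leads_to_root F x y \<longleftrightarrow> y = x"
  by (auto simp: leads_to_root_def Not_Domain_rtrancl)

text \<open>
  Following outgoing arcs must stop, since a finite acyclic relation has no infinite ascending chain.
\<close>

lemma ex_leads_to_root:
  assumes "finite F" "acyclic F"
  shows "\<exists>y. leads_to_root F x y"
proof -
  have "wf (F\<inverse>)"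
    using assms by (rule finite_acyclic_wf_converse)
  then show ?thesis
  proof (induction x rule: wf_induct_rule)
    case (less x)
    show ?case
    proof (cases "x \<in> Domain F")
      case True
      then obtain u where "(x, u) \<in> F" by auto
      with less[of u] show ?thesis
        by (auto simp: leads_to_root_def intro: converse_rtrancl_into_rtrancl)
    next
      case False
      then show ?thesis by (auto simp: leads_to_root_def)
    qed
  qed
qed

lemma leads_to_root_in:
  assumes "F \<subseteq> K \<times> K" "x \<in> K" "leads_to_root F x y"
  shows "y \<in> K - Domain F"
  using assms by (auto simp: leads_to_root_def elim: rtranclE)

text \<open>
  How roots change when the root \<open>x\<close> is given an arc to another tree: the tree of \<open>x\<close> is hung below
  \<open>a\<close> and inherits its root, and all other vertices keep theirs.
\<close>

lemma leads_to_root_insert: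
  assumes "single_valued H" "x \<notin> Domain H" "(a, x) \<notin> H\<^sup>*"
  shows "leads_to_root (insert (x, a) H) u y \<longleftrightarrow>
    (if (u, x) \<in> H\<^sup>* then leads_to_root H a y else leads_to_root H u y)"
proof -
  have "y = x" if "(u, x) \<in> H\<^sup>*" "(u, y) \<in> H\<^sup>*" "y \<notin> Domain H"
    using leads_to_root_unique[OF assms(1), of u y x] that assms(2)
    by (auto simp: leads_to_root_def)
  then show ?thesis
    using assms by (auto simp: leads_to_root_def rtrancl_insert)
qed

text \<open>
  With a single root, wherever a walk stops, it stops there.
\<close>

lemma rtrancl_unique_root:
  assumes "finite F" "acyclic F" "F \<subseteq> V \<times> V" "Domain F = V - {r}" "v \<in> V"
  shows "(v, r) \<in> F\<^sup>*"
proof -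
  obtain z where z: "leads_to_root F v z"
    using ex_leads_to_root[OF assms(1,2)] by blast
  then have "z \<in> V - Domain F"
    using leads_to_root_in assms(3,5) by metis
  then have "z = r" using assms(4) by auto
  with z show ?thesis by (simp add: leads_to_root_def)
qed

lemma acyclic_Un_disjoint:
  assumes "finite F" "finite H" "acyclic F" "acyclic H" "Domain F \<inter> Range H = {}"
  shows "acyclic (F \<union> H)"
  by (rule wf_acyclic, rule wf_Un) (use assms finite_acyclic_wf in auto)

lemma card_forest_roots:
  assumes "finite K" "F \<subseteq> K \<times> K" "single_valued F"
  shows "card F + card (K - Domain F) = card K"
proof -
  have "inj_on fst F" using assms(3) by (auto simp: inj_on_def single_valued_def)
  then have "card (Domain F) = card F" by (simp add: Domain_fst card_image)
  moreover have "Domain F \<subseteq> K" using assms(2) by auto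
  ultimately show ?thesis
    using assms(1) card_mono[of K "Domain F"] by (simp add: card_Diff_subset finite_subset)
qed

lemma rooted_forests_iff:
  assumes "finite K" "A \<subseteq> K \<times> K"
  shows "F \<in> rooted_forests K A j \<longleftrightarrow>
    F \<subseteq> A \<and> single_valued F \<and> acyclic F \<and> card (K - Domain F) = j"
proof -
  have "card F + j = card K \<longleftrightarrow> card (K - Domain F) = j" if "F \<subseteq> A" "single_valued F"
  proof -
    have "F \<subseteq> K \<times> K" using that(1) assms(2) by (rule subset_trans)
    from card_forest_roots[OF assms(1) this that(2)] show ?thesis by linarith
  qed
  then show ?thesis by (auto simp: rooted_forests_def)
qed

lemma rel_weight_insert:
  assumes "finite H" "x \<notin> Domain H"
  shows "rel_weight k (insert (x, a) H) = k x a * rel_weight k H"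
proof -
  have "(x, a) \<notin> H" using assms(2) by auto
  then show ?thesis using assms(1) by (simp add: rel_weight_def)
qed

lemma forest_sum_filter:
  assumes "finite A"
  shows "forest_sum K A k j x y = (\<Sum>F\<in>{F\<in>rooted_forests K A j. leads_to_root F x y}. rel_weight k F)"
  unfolding forest_sum_def
  using finite_rooted_forests[OF assms]
  by (intro sum.mono_neutral_cong_right) auto

text \<open>
  Each forest is counted once, at the root to which it leads \<open>x\<close>.
\<close>

lemma forest_sum_row:
  assumes "finite K" "A \<subseteq> K \<times> K" "x \<in> K"
  shows "(\<Sum>y\<in>K. forest_sum K A k j x y) = total_forest_sum K A k j"
proof -
  have "(\<Sum>y\<in>K. of_bool (leads_to_root F x y)) = (1 :: real)"
    if "F \<in> rooted_forests K A j" for F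
  proof -
    have F: "finite F" "single_valued F" "acyclic F" "F \<subseteq> K \<times> K"
      using that assms by (auto simp: rooted_forests_def intro: finite_subset[of F "K \<times> K"])
    obtain z where z: "leads_to_root F x z"
      using ex_leads_to_root[OF F(1,3)] by blast
    then have "z \<in> K" using leads_to_root_in[OF F(4) assms(3)] by simp
    have "leads_to_root F x y \<longleftrightarrow> y = z" for y
      using z leads_to_root_unique[OF F(2) z, of y] by blast
    then show ?thesis
      using \<open>z \<in> K\<close> assms(1) by (simp add: of_bool_def)
  qed
  then show ?thesis
    unfolding forest_sum_def total_forest_sum_def
    by (subst sum.swap) (simp add: sum_distrib_left[symmetric])
qed


section \<open>The generator acting on forest sums\<close>

text \<open>
  A forest in which \<open>x\<close> is not a root is cut at the arc leaving \<open>x\<close>. What remains is a forest with \<open>x\<close>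
  as an additional root, and the arc can be put back exactly when its head lies outside the tree of
  \<open>x\<close>, for otherwise it would close a cycle.
\<close>

lemma sum_rooted_forests_through:
  assumes "finite A"
  shows "(\<Sum>F\<in>{F\<in>rooted_forests K A i. x \<in> Domain F}. g F) =
    (\<Sum>H\<in>{H\<in>rooted_forests K A (Suc i). x \<notin> Domain H}.
       \<Sum>a\<in>{a\<in>A `` {x}. (a, x) \<notin> H\<^sup>*}. g (insert (x, a) H))"
proof -
  let ?R = "SIGMA H:{H\<in>rooted_forests K A (Suc i). x \<notin> Domain H}. {a\<in>A `` {x}. (a, x) \<notin> H\<^sup>*}"
  define out where "out F = (THE a. (x, a) \<in> F)" for F :: "'a rel"
  let ?ins = "\<lambda>(H, a). insert (x, a) H" and ?cut = "\<lambda>F. (F - {(x, out F)}, out F)"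
  have out: "(x, out F) \<in> F" "\<And>a. (x, a) \<in> F \<Longrightarrow> a = out F"
    if "F \<in> rooted_forests K A i" "x \<in> Domain F" for F
  proof -
    have "\<exists>!a. (x, a) \<in> F"
      using that by (auto simp: rooted_forests_def single_valued_def)
    then show "(x, out F) \<in> F" "\<And>a. (x, a) \<in> F \<Longrightarrow> a = out F"
      unfolding out_def by (auto intro: theI' the1_equality[symmetric])
  qed
  have "(\<Sum>F\<in>{F\<in>rooted_forests K A i. x \<in> Domain F}. g F) =
      (\<Sum>(H, a)\<in>?R. g (insert (x, a) H))"
  proof (rule sum.reindex_bij_witness
[where i = ?ins and j = ?cut])
    fix F assume "F \<in> {F\<in>rooted_forests K A i. x \<in> Domain F}"
    then have F: "F \<in> rooted_forests K A i" "x \<in> Domain F" by auto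
    note o = out[OF F]
    show "?ins (?cut F) = F" "(case ?cut F of (H, a) \<Rightarrow> g (insert (x, a) H)) = g F"
      by (simp_all add: insert_absorb[OF o(1)])
    have fin: "finite F" using F assms by (auto simp: rooted_forests_def intro: finite_subset)
    have "acyclic F" using F by (auto simp: rooted_forests_def)
    then have "acyclic (insert (x, out F) (F - {(x, out F)}))"
      by (simp only: insert_Diff[OF o(1)])
    then have "(out F, x) \<notin> (F - {(x, out F)})\<^sup>*"
      by (simp only: acyclic_insert) simp
    moreover have "card (F - {(x, out F)}) + Suc i = card K"
      using card.remove[OF fin o(1)] F by (simp add: rooted_forests_def)
    moreover have "acyclic (F - {(x, out F)})"
      using \<open>acyclic F\<close> by (rule acyclic_subset) auto
    moreover have "single_valued (F - {(x, out F)})"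
      using F by (auto simp: rooted_forests_def intro: single_valued_subset[of _ F])
    moreover have "x \<notin> Domain (F - {(x, out F)})"
      using o(2) by blast
    ultimately show "?cut F \<in> ?R"
      using F(1) o(1) by (auto simp: rooted_forests_def)
  next
    fix p assume "p \<in> ?R"
    then obtain H a where p: "p = (H, a)" and H: "H \<in> rooted_forests K A (Suc i)" "x \<notin> Domain H"
      and a: "(x, a) \<in> A" "(a, x) \<notin> H\<^sup>*" by auto
    have fin: "finite H" using H assms by (auto simp: rooted_forests_def intro: finite_subset)
    have "card (insert (x, a) H) = Suc (card H)"
      using fin H by (subst card_insert_disjoint) auto
    then have I: "insert (x, a) H \<in> rooted_forests K A i"
      using H a by (auto simp: rooted_forests_def acyclic_insert single_valued_def)
    then show "?ins p \<in> {F\<in>rooted_forests K A i. x \<in> Domain F}"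
      by (simp add: p)
    have "out (insert (x, a) H) = a"
      using out(2)[OF I, of a] by auto
    then show "?cut (?ins p) = p"
      using H by (auto simp: p)
  qed
  also have "\<dots> = (\<Sum>H\<in>{H\<in>rooted_forests K A (Suc i). x \<notin> Domain H}.
       \<Sum>a\<in>{a\<in>A `` {x}. (a, x) \<notin> H\<^sup>*}. g (insert (x, a) H))"
    using finite_rooted_forests[OF assms] finite_Image[OF assms, of "{x}"]
    by (subst sum.Sigma) (auto simp: Image_singleton)
  finally show ?thesis .
qed

text \<open>
  The summand changes its sign when \<open>a\<close> and \<open>u\<close> are exchanged.
\<close>

lemma sum_antisym_zero:
  fixes c d :: "'b \<Rightarrow> real"
  shows "(\<Sum>a\<in>S. \<Sum>u\<in>S. c u * c a * (d u - d a)) = 0"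
proof -
  have "(\<Sum>a\<in>S. \<Sum>u\<in>S. c u * c a * (d u - d a)) = (\<Sum>a\<in>S. \<Sum>u\<in>S. c a * c u * (d a - d u))"
    by (rule sum.swap)
  also have "\<dots> = - (\<Sum>a\<in>S. \<Sum>u\<in>S. c u * c a * (d u - d a))"
    by (simp add: sum_negf[symmetric] algebra_simps)
  finally show ?thesis by simp
qed

text \<open>
  The combinatorial core. In matrix notation it reads \<open>L N\<^sub>j\<^sub>+\<^sub>1 = N\<^sub>j - W\<^sub>j I\<close>, where \<open>N\<^sub>j x y\<close> is the
  weight of the forests with \<open>j\<close> roots in which \<open>x\<close> leads to \<open>y\<close>, and \<open>W\<^sub>j\<close> is the weight of all forests
  with \<open>j\<close> roots.

  The left-hand side is a sum over a forest \<open>F\<close> with \<open>j + 1\<close> roots and an arc \<open>(x, u)\<close>. Suppose first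
  that \<open>F\<close> has an arc \<open>(x, a)\<close>, and let \<open>H\<close> be \<open>F\<close> without this arc. If \<open>u\<close> lies in the tree of \<open>x\<close> in
  \<open>H\<close>, then \<open>u\<close> and \<open>x\<close> have the same root in \<open>F\<close>. If not, the root of \<open>u\<close> in \<open>F\<close> is its root in \<open>H\<close>,
  and that of \<open>x\<close> is the root of \<open>a\<close> in \<open>H\<close>; so the term changes its sign when \<open>a\<close> and \<open>u\<close> are
  exchanged, and the sum over both is zero. Suppose now that \<open>x\<close> is a root of \<open>F\<close>. The arc contributes
  only if \<open>u\<close> lies in another tree, and then adding it gives a forest with \<open>j\<close> roots in which \<open>x\<close> is
  not a root. All of these arise once, and those with \<open>j\<close> roots in which \<open>x\<close> is a root contribute
  zero to the right-hand side.
\<close>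

lemma forest_sum_backward:
  assumes A: "finite A"
  shows "(\<Sum>u\<in>A `` {x}. k x u * (forest_sum K A k (Suc j) u y - forest_sum K A k (Suc j) x y))
    = forest_sum K A k j x y - of_bool (x = y) * total_forest_sum K A k j"
proof -
  define Fs where "Fs i = rooted_forests K A i" for i
  define S where "S H = {a\<in>A `` {x}. (a, x) \<notin> H\<^sup>*}" for H
  define b where "b F u = (of_bool (leads_to_root F u y) :: real)" for F u
  define t where "t F = (\<Sum>u\<in>A `` {x}. k x u * (rel_weight k F * (b F u - b F x)))" for F
  have finF: "finite (Fs i)" for i
    using A by (simp add: Fs_def finite_rooted_forests)
  have finA: "finite (A `` {x})" using A by (rule finite_Image)
  have FsD: "finite F" "single_valued F" if "F \<in> Fs i" for F i
    using that A by (auto simp: Fs_def rooted_forests_def intro: finite_subset)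
  have split: "(\<Sum>F\<in>Fs i. g F) =
      (\<Sum>F\<in>{F\<in>Fs i. x \<in> Domain F}. g F) + (\<Sum>F\<in>{F\<in>Fs i. x \<notin> Domain F}. g F)"
    for i and g :: "'a rel \<Rightarrow> real"
    using finF by (subst sum.union_disjoint[symmetric]) (auto intro!: sum.cong)
  \<comment> \<open>\<open>leads_to_root_insert\<close> in terms of indicators; it holds for \<open>u = x\<close> too.\<close>
  have b_insert: "b (insert (x, a) H) u = (if (u, x) \<in> H\<^sup>* then b H a else b H u)"
    if "H \<in> Fs i" "x \<notin> Domain H" "a \<in> S H" for H i a u
    using that FsD by (simp add: b_def S_def leads_to_root_insert)
  \<comment> \<open>If \<open>x\<close> is a root, then the vertices of its tree contribute nothing.\<close>
  have t_S: "t F = (\<Sum>u\<in>S F. k x u * (rel_weight k F * (b F u - b F x)))"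
    if "F \<in> Fs i" "x \<notin> Domain F" for F i
  proof -
    have *: "b F u - b F x = 0" if "(u, x) \<in> F\<^sup>*" for u
    proof -
      have "leads_to_root F u x"
        using that \<open>x \<notin> Domain F\<close> by (simp add: leads_to_root_def)
      then have "leads_to_root F u y \<longleftrightarrow> y = x"
        using leads_to_root_unique FsD(2)[OF \<open>F \<in> Fs i\<close>] by metis
      then show ?thesis
        using leads_to_root_at_root[OF \<open>x \<notin> Domain F\<close>] by (simp add: b_def)
    qed
    show ?thesis
      unfolding t_def using finA
      by (intro sum.mono_neutral_right) (auto simp: S_def *)
  qed
  have "(\<Sum>u\<in>A `` {x}. k x u * (forest_sum K A k (Suc j) u y - forest_sum K A k (Suc j) x y))
      = (\<Sum>u\<in>A `` {x}. \<Sum>F\<in>Fs (Suc j). k x u * (rel_weight k F * (b F u - b F x)))"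
    by (simp add: forest_sum_def Fs_def b_def sum_distrib_left sum_subtractf[symmetric]
        right_diff_distrib)
  also have "\<dots> = (\<Sum>F\<in>Fs (Suc j). t F)"
    unfolding t_def by (rule sum.swap)
  also have "\<dots> = (\<Sum>F\<in>{F\<in>Fs (Suc j). x \<in> Domain F}. t F) + (\<Sum>F\<in>{F\<in>Fs (Suc j). x \<notin> Domain F}. t F)"
    by (rule split)
  also have "(\<Sum>F\<in>{F\<in>Fs (Suc j). x \<in> Domain F}. t F) = 0"
  proof -
    have "(\<Sum>F\<in>{F\<in>Fs (Suc j). x \<in> Domain F}. t F) =
        (\<Sum>H\<in>{H\<in>Fs (Suc (Suc j)). x \<notin> Domain H}. \<Sum>a\<in>S H. t (insert (x, a) H))"
      unfolding Fs_def S_def by (rule sum_rooted_forests_through[OF A])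
    also have "\<dots> = 0"
    proof (rule sum.neutral, safe)
      fix H assume H: "H \<in> Fs (Suc (Suc j))" "x \<notin> Domain H"
      have "t (insert (x, a) H) = rel_weight k H * (\<Sum>u\<in>S H. k x u * k x a * (b H u - b H a))"
        if a: "a \<in> S H" for a
      proof -
        have "t (insert (x, a) H) = (\<Sum>u\<in>A `` {x}. k x u * (k x a * rel_weight k H *
            (if (u, x) \<in> H\<^sup>* then 0 else b H u - b H a)))"
          using FsD(1) H a unfolding t_def
          by (intro sum.cong) (auto simp: rel_weight_insert b_insert[OF H a])
        also have "\<dots> = (\<Sum>u\<in>S H. k x u * (k x a * rel_weight k H * (b H u - b H a)))"
          using finA by (intro sum.mono_neutral_cong_right) (auto simp: S_def)
        finally show ?thesis
          by (simp add: sum_distrib_left mult_ac)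
      qed
      then have "(\<Sum>a\<in>S H. t (insert (x, a) H)) =
          rel_weight k H * (\<Sum>a\<in>S H. \<Sum>u\<in>S H. k x u * k x a * (b H u - b H a))"
        by (simp add: sum_distrib_left)
      then show "(\<Sum>a\<in>S H. t (insert (x, a) H)) = 0"
        by (simp add: sum_antisym_zero)
    qed
    finally show ?thesis .
  qed
  also have "(\<Sum>F\<in>{F\<in>Fs (Suc j). x \<notin> Domain F}. t F) =
      (\<Sum>F\<in>{F\<in>Fs j. x \<in> Domain F}. rel_weight k F * (b F x - of_bool (x = y)))"
  proof -
    have "(\<Sum>F\<in>{F\<in>Fs j. x \<in> Domain F}. rel_weight k F * (b F x - of_bool (x = y))) =
      (\<Sum>H\<in>{H\<in>Fs (Suc j). x \<notin> Domain H}. \<Sum>a\<in>S H.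
         rel_weight k (insert (x, a) H) * (b (insert (x, a) H) x - of_bool (x = y)))"
      unfolding Fs_def S_def by (rule sum_rooted_forests_through[OF A])
    also have "\<dots> = (\<Sum>F\<in>{F\<in>Fs (Suc j). x \<notin> Domain F}. t F)"
    proof (rule sum.cong[OF refl], clarify)
      fix H assume H: "H \<in> Fs (Suc j)" "x \<notin> Domain H"
      have "b H x = of_bool (x = y)"
        using leads_to_root_at_root[OF H(2)] by (auto simp: b_def)
      then show "(\<Sum>a\<in>S H. rel_weight k (insert (x, a) H) *
          (b (insert (x, a) H) x - of_bool (x = y))) = t H"
        unfolding t_S[OF H] using FsD(1)[OF H(1)] H
        by (intro sum.cong) (simp_all add: rel_weight_insert b_insert[OF H] mult_ac)
    qed
    finally show ?thesis by simp
  qed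
  also have "\<dots> = (\<Sum>F\<in>Fs j. rel_weight k F * (b F x - of_bool (x = y)))"
    using finF by (intro sum.mono_neutral_left) (auto simp: b_def leads_to_root_at_root)
  also have "\<dots> = forest_sum K A k j x y - of_bool (x = y) * total_forest_sum K A k j"
    by (simp add: forest_sum_def total_forest_sum_def Fs_def b_def right_diff_distrib
        sum_subtractf sum_distrib_left mult.commute)
  finally show ?thesis by simp
qed


section \<open>Trees and forests of the rate digraph\<close>

text \<open>
  Subgraphs of the rate digraph share its projections, hence they are determined by their vertices
  and arcs.
\<close>

definition digraph_of :: "'a set \<Rightarrow> 'a rel \<Rightarrow> ('a, 'a \<times> 'a) pre_digraph" where
  "digraph_of V F = \<lparr>verts = V, arcs = F, tail = fst, head = snd\<rparr>"

lemma digraph_of_sel [simp]: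
  "verts (digraph_of V F) = V" "arcs (digraph_of V F) = F"
  "tail (digraph_of V F) = fst" "head (digraph_of V F) = snd"
  by (simp_all add: digraph_of_def)

lemma digraph_of_eqI: "tail T = fst \<Longrightarrow> head T = snd \<Longrightarrow> T = digraph_of (verts T) (arcs T)"
  by (simp add: digraph_of_def)

lemma wf_digraph_digraph_of: "wf_digraph (digraph_of V F) \<longleftrightarrow> F \<subseteq> V \<times> V"
  by (force simp: wf_digraph_def)

lemma arcs_ends_digraph_of [simp]: "arcs_ends (digraph_of V F) = F"
  by (simp add: arcs_ends_conv)

lemma forest_digraph_of:
  assumes "F \<subseteq> V \<times> V"
  shows "forest (digraph_of V F) \<longleftrightarrow> acyclic F"
proof -
  interpret wf_digraph "digraph_of V F" using assms by (simp add: wf_digraph_digraph_of)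
  have "(\<exists>p. cycle p) \<longleftrightarrow> (\<exists>u p. awalk u p u \<and> p \<noteq> [])"
    using closed_w_imp_cycle by (auto simp: cycle_def closed_w_def)
  also have "\<dots> \<longleftrightarrow> \<not> acyclic F"
    using reachable1_awalk by (auto simp: acyclic_def)
  finally show ?thesis by (simp add: forest_def)
qed

text \<open>
  The library notion of connectedness is strong connectedness of the symmetrised digraph: two
  vertices that both reach \<open>r\<close> are joined through \<open>r\<close>.
\<close>

lemma connected_digraph_of:
  assumes "F \<subseteq> V \<times> V" "r \<in> V" "\<And>v. v \<in> V \<Longrightarrow> (v, r) \<in> F\<^sup>*"
  shows "connected (digraph_of V F)"
proof -
  interpret D: wf_digraph "digraph_of V F" using assms by (simp add: wf_digraph_digraph_of)
  let ?M = "with_proj (mk_symmetric (digraph_of V F))"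
  have to_r: "v \<rightarrow>\<^sup>*\<^bsub>?M\<^esub> r" if "v \<in> V" for v
  proof (rule D.reachable_mk_symmetricI)
    show "v \<rightarrow>\<^sup>*\<^bsub>digraph_of V F\<^esub> r"
      unfolding reachable_def digraph_of_sel arcs_ends_digraph_of
      by (rule rtrancl_consistent_rtrancl_on) (use assms that in auto)
  qed
  have "u \<rightarrow>\<^sup>*\<^bsub>?M\<^esub> v" if "u \<in> V" "v \<in> V" for u v
    using to_r[OF that(1)] symmetric_reachable[OF symmetric_mk_symmetric to_r[OF that(2)]]
    unfolding reachable_def by (rule rtrancl_on_trans)
  then show ?thesis
    unfolding connected_def using assms(2)
    by (intro strongly_connectedI) auto
qed

lemma rate_digraph_eq: "rate_digraph K k = digraph_of K (arcs (rate_digraph K k))"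
  by (simp add: rate_digraph_def digraph_of_def)

lemma arcs_rate_digraph_subset: "arcs (rate_digraph K k) \<subseteq> K \<times> K"
  by (auto simp: rate_digraph_def)

lemma finite_arcs_rate_digraph: "finite K \<Longrightarrow> finite (arcs (rate_digraph K k))"
  using arcs_rate_digraph_subset by (rule finite_subset) simp

lemma subgraph_rate_digraph:
  "subgraph T (rate_digraph K k) \<longleftrightarrow> tail T = fst \<and> head T = snd \<and> verts T \<subseteq> K \<and>
     arcs T \<subseteq> arcs (rate_digraph K k) \<and> arcs T \<subseteq> verts T \<times> verts T"
proof (cases "tail T = fst \<and> head T = snd")
  case True
  then obtain V F where T: "T = digraph_of V F" using digraph_of_eqI by blast
  have "wf_digraph (rate_digraph K k)"
    using arcs_rate_digraph_subset by (subst rate_digraph_eq) (simp add: wf_digraph_digraph_of)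
  then show ?thesis
    unfolding T subgraph_def
    by (auto simp: wf_digraph_digraph_of compatible_def rate_digraph_def)
next
  case False
  then show ?thesis by (auto simp: subgraph_def compatible_def rate_digraph_def)
qed

lemma card_out_eq_1:
  "card {e \<in> F. fst e = v} = 1 \<longleftrightarrow> (\<exists>!a. (v, a) \<in> F)"
proof -
  have "{e \<in> F. fst e = v} = Pair v ` {a. (v, a) \<in> F}" by auto
  then have "card {e \<in> F. fst e = v} = card {a. (v, a) \<in> F}"
    by (simp add: card_image inj_on_def)
  also have "\<dots> = 1 \<longleftrightarrow> (\<exists>!a. (v, a) \<in> F)"
    unfolding One_nat_def card_1_singleton_iff set_eq_iff mem_Collect_eq singleton_iff by metis
  finally show ?thesis .
qed

lemma ex1_iff_Domain_single_valued:
  assumes "Domain F \<subseteq> V"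
  shows "r \<notin> Domain F \<and> (\<forall>v\<in>V - {r}. \<exists>!a. (v, a) \<in> F) \<longleftrightarrow>
    Domain F = V - {r} \<and> single_valued F"
proof (intro iffI conjI; elim conjE)
  assume r: "r \<notin> Domain F" and ex1: "\<forall>v\<in>V - {r}. \<exists>!a. (v, a) \<in> F"
  show "Domain F = V - {r}"
  proof
    show "Domain F \<subseteq> V - {r}" using assms r by blast
    show "V - {r} \<subseteq> Domain F" using ex1 by (meson DomainI subsetI)
  qed
  show "single_valued F"
  proof (rule single_valuedI)
    fix v a b assume ab: "(v, a) \<in> F" "(v, b) \<in> F"
    then have "v \<in> V - {r}" using assms r by blast
    with ab show "a = b" using ex1 by blast
  qed
next
  assume *: "Domain F = V - {r}" "single_valued F"
  then show "r \<notin> Domain F" by simp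
  show "\<forall>v\<in>V - {r}. \<exists>!a. (v, a) \<in> F"
  proof
    fix v assume "v \<in> V - {r}"
    then obtain a where "(v, a) \<in> F" using *(1) by blast
    then show "\<exists>!a. (v, a) \<in> F" using single_valuedD[OF *(2)] by blast
  qed
qed

lemma rooted_tree_rate_digraph:
  assumes "finite K"
  shows "rooted_tree (rate_digraph K k) r T \<longleftrightarrow>
    tail T = fst \<and> head T = snd \<and> verts T \<subseteq> K \<and>
    arcs T \<subseteq> arcs (rate_digraph K k) \<and> arcs T \<subseteq> verts T \<times> verts T \<and>
    r \<in> verts T \<and> Domain (arcs T) = verts T - {r} \<and> single_valued (arcs T) \<and> acyclic (arcs T)"
proof (cases "tail T = fst \<and> head T = snd \<and> verts T \<subseteq> K \<and>
    arcs T \<subseteq> arcs (rate_digraph K k) \<and> arcs T \<subseteq> verts T \<times> verts T \<and> r \<in> verts T")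
  case True
  then obtain V F where T: "T = digraph_of V F" using digraph_of_eqI by blast
  have F: "F \<subseteq> V \<times> V" "r \<in> V" "V \<subseteq> K" "F \<subseteq> arcs (rate_digraph K k)" using True by (auto simp: T)
  have "finite V" using assms F(3) by (rule finite_subset[rotated])
  then have "finite F" using F(1) by (meson finite_SigmaI finite_subset)
  have out: "out_arcs T r = {} \<and> (\<forall>v\<in>V - {r}. out_degree T v = 1) \<longleftrightarrow>
      Domain F = V - {r} \<and> single_valued F"
  proof -
    have "out_arcs T r = {} \<longleftrightarrow> r \<notin> Domain F"
      by (auto simp: T out_arcs_def)
    moreover have "out_degree T v = 1 \<longleftrightarrow> (\<exists>!a. (v, a) \<in> F)" for v
      unfolding out_degree_def out_arcs_def by (simp add: T card_out_eq_1[simplified])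
    moreover have "Domain F \<subseteq> V" using F(1) by auto
    ultimately show ?thesis
      using ex1_iff_Domain_single_valued[of F V r] by simp
  qed
  have "connected T" if "Domain F = V - {r}" "acyclic F"
    unfolding T using F that \<open>finite F\<close>
    by (intro connected_digraph_of[of F V r] rtrancl_unique_root) auto
  moreover have "forest T \<longleftrightarrow> acyclic F"
    unfolding T using F(1) by (rule forest_digraph_of)
  ultimately show ?thesis
    using out F unfolding rooted_tree_def tree_def subgraph_rate_digraph by (auto simp: T)
next
  case False
  then show ?thesis by (auto simp: rooted_tree_def subgraph_rate_digraph)
qed

text \<open>
  The tree of a root in a forest, cut out as the set of vertices that reach the root.
\<close>

lemma rooted_tree_component:
  assumes "finite K" "F \<subseteq> arcs (rate_digraph K k)" "single_valued F" "acyclic F"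
    and "r \<in> K" "r \<notin> Domain F"
  defines "V \<equiv> {v \<in> K. (v, r) \<in> F\<^sup>*}"
  shows "rooted_tree (rate_digraph K k) r (digraph_of V (F \<inter> V \<times> V))"
proof -
  have "v \<in> Domain (F \<inter> V \<times> V)" if "v \<in> V" "v \<noteq> r" for v
  proof -
    from that obtain a where a: "(v, a) \<in> F" "(a, r) \<in> F\<^sup>*"
      by (auto simp: V_def elim: converse_rtranclE)
    then have "a \<in> V"
      using assms(2) arcs_rate_digraph_subset[of K k] by (auto simp: V_def)
    with a that show ?thesis by auto
  qed
  then have "Domain (F \<inter> V \<times> V) = V - {r}"
    using assms(6) by blast
  moreover have "acyclic (F \<inter> V \<times> V)"
    using assms(4) by (rule acyclic_subset) auto
  moreover have "single_valued (F \<inter> V \<times> V)"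
    using assms(3) by (rule single_valued_subset[rotated]) auto
  moreover have "V \<subseteq> K" "r \<in> V" "F \<inter> V \<times> V \<subseteq> arcs (rate_digraph K k)"
    using assms(2,5) by (auto simp: V_def)
  ultimately show ?thesis
    using assms(1) by (simp add: rooted_tree_rate_digraph)
qed

lemma spanning_trees_at_rate_digraph:
  assumes "finite K" "x \<in> K"
  shows "spanning_trees_at (rate_digraph K k) x =
    digraph_of K ` {F \<in> rooted_forests K (arcs (rate_digraph K k)) 1. x \<notin> Domain F}"
    (is "?L = digraph_of K ` ?R")
proof
  let ?A = "arcs (rate_digraph K k)"
  note iff = rooted_forests_iff[OF assms(1) arcs_rate_digraph_subset]
  show "?L \<subseteq> digraph_of K ` ?R"
  proof
    fix T assume "T \<in> ?L"
    then have T: "rooted_tree (rate_digraph K k) x T" "verts T = K"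
      by (auto simp: spanning_trees_at_def spanning_def rate_digraph_def)
    then have "K - Domain (arcs T) = {x}"
      using assms by (auto simp: rooted_tree_rate_digraph)
    then have "arcs T \<in> ?R"
      using T assms by (auto simp: rooted_tree_rate_digraph iff)
    moreover have "T = digraph_of K (arcs T)"
      using T assms digraph_of_eqI[of T] by (simp add: rooted_tree_rate_digraph)
    ultimately show "T \<in> digraph_of K ` ?R" by blast
  qed
  show "digraph_of K ` ?R \<subseteq> ?L"
  proof clarify
    fix F assume F: "F \<in> rooted_forests K ?A 1" "x \<notin> Domain F"
    then have FA: "F \<subseteq> ?A" "F \<subseteq> K \<times> K"
      using arcs_rate_digraph_subset[of K k] by (auto simp: iff)
    have "card (K - Domain F) = 1" using F by (simp add: iff)
    then obtain r where "K - Domain F = {r}" by (auto simp: card_1_singleton_iff)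
    moreover have "x \<in> K - Domain F" "Domain F \<subseteq> K" using F(2) assms(2) FA(2) by blast+
    ultimately have "Domain F = K - {x}" by auto
    then show "digraph_of K F \<in> ?L"
      using F FA assms
      by (simp add: spanning_trees_at_def spanning_def subgraph_rate_digraph
          rooted_tree_rate_digraph iff) (simp add: rate_digraph_def)
  qed
qed

lemma two_tree_forests_rate_digraph:
  assumes "finite K" "x \<in> K" "y \<in> K"
  shows "two_tree_forests (rate_digraph K k) x y =
    digraph_of K ` {F \<in> rooted_forests K (arcs (rate_digraph K k)) 2. leads_to_root F x y}"
    (is "?L = digraph_of K ` ?R")
proof
  let ?G = "rate_digraph K k" and ?A = "arcs (rate_digraph K k)"
  have finA: "finite ?A"
    using assms(1) by (rule finite_arcs_rate_digraph)
  note iff = rooted_forests_iff[OF assms(1) arcs_rate_digraph_subset]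
  show "?L \<subseteq> digraph_of K ` ?R"
  proof
    fix U assume "U \<in> ?L"
    then obtain T1 T2 z where U: "U = union T1 T2"
      and T1: "rooted_tree ?G y T1" and T2: "rooted_tree ?G z T2"
      and disj: "verts T1 \<inter> verts T2 = {}" and "spanning U ?G" and x: "x \<in> verts T1"
      unfolding two_tree_forests_def by blast
    then have K: "K = verts T1 \<union> verts T2"
      by (auto simp: spanning_def union_def rate_digraph_def)
    have 1: "tail T1 = fst" "head T1 = snd" "arcs T1 \<subseteq> ?A" "arcs T1 \<subseteq> verts T1 \<times> verts T1"
      "Domain (arcs T1) = verts T1 - {y}" "y \<in> verts T1" "single_valued (arcs T1)" "acyclic (arcs T1)"
      using T1 by (simp_all add: rooted_tree_rate_digraph[OF assms(1)])
    have 2: "arcs T2 \<subseteq> ?A" "arcs T2 \<subseteq> verts T2 \<times> verts T2"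
      "Domain (arcs T2) = verts T2 - {z}" "z \<in> verts T2" "single_valued (arcs T2)" "acyclic (arcs T2)"
      using T2 by (simp_all add: rooted_tree_rate_digraph[OF assms(1)])
    define F where "F = arcs T1 \<union> arcs T2"
    have fin: "finite (arcs T1)" "finite (arcs T2)"
      using 1(3) 2(1) finA by (simp_all add: finite_subset)
    have "Domain (arcs T1) \<inter> Range (arcs T2) = {}"
      using 1(4) 2(2) disj by blast
    then have "acyclic F"
      unfolding F_def by (rule acyclic_Un_disjoint[OF fin 1(8) 2(6)])
    moreover have "Domain (arcs T1) \<inter> Domain (arcs T2) = {}"
      using 1(5) 2(3) disj by blast
    then have "single_valued F"
      using 1(7) 2(5) unfolding F_def single_valued_def by blast
    moreover have "K - Domain F = {y, z}" "y \<noteq> z"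
      using 1(5,6) 2(3,4) disj by (auto simp: K F_def Domain_Un_eq)
    moreover have "(x, y) \<in> F\<^sup>*"
    proof -
      have "(x, y) \<in> (arcs T1)\<^sup>*"
        by (rule rtrancl_unique_root[OF fin(1) 1(8,4,5) x])
      then show ?thesis unfolding F_def using rtrancl_mono[of "arcs T1"] by blast
    qed
    moreover have "F \<subseteq> ?A" using 1(3) 2(1) by (simp add: F_def)
    ultimately have "F \<in> ?R" by (auto simp: iff leads_to_root_def)
    moreover have "U = digraph_of K F"
      using 1(1,2) by (simp add: U union_def digraph_of_def K F_def)
    ultimately show "U \<in> digraph_of K ` ?R" by blast
  qed
  show "digraph_of K ` ?R \<subseteq> ?L"
  proof clarify
    fix F assume "F \<in> rooted_forests K ?A 2" and xy: "leads_to_root F x y"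
    then have F: "F \<subseteq> ?A" "single_valued F" "acyclic F" "card (K - Domain F) = 2"
      by (auto simp: iff)
    have FK: "F \<subseteq> K \<times> K" using F(1) arcs_rate_digraph_subset[of K k] by blast
    have "finite F" using F(1) finA by (rule finite_subset)
    have y: "y \<in> K - Domain F" using leads_to_root_in FK assms(2) xy by metis
    then have "card (K - Domain F - {y}) = 1"
      using F(4) by simp
    then obtain z where "K - Domain F - {y} = {z}"
      unfolding One_nat_def card_1_singleton_iff by blast
    with y have z: "K - Domain F = {y, z}" "y \<noteq> z"
      by blast+
    define V where "V r = {v \<in> K. (v, r) \<in> F\<^sup>*}" for r
    define T where "T r = digraph_of (V r) (F \<inter> V r \<times> V r)" for r
    have T: "rooted_tree ?G r (T r)" if "r \<in> {y, z}" for r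
      unfolding T_def V_def using assms(1) F that z
      by (intro rooted_tree_component) auto
    have cover: "v \<in> V y \<or> v \<in> V z" if v: "v \<in> K" for v
    proof -
      obtain r where r: "leads_to_root F v r"
        using ex_leads_to_root[OF \<open>finite F\<close> F(3)] by blast
      then have "r \<in> {y, z}" using leads_to_root_in[OF FK v r] z by simp
      then show ?thesis using r v by (auto simp: V_def leads_to_root_def)
    qed
    have "V y \<inter> V z = {}"
      using leads_to_root_unique[OF F(2), of _ y z] z by (auto simp: V_def leads_to_root_def)
    moreover have "x \<in> V y" using xy assms(2) by (simp add: V_def leads_to_root_def)
    moreover have "digraph_of K F = union (T y) (T z)"
    proof -
      have "K = V y \<union> V z" using cover by (auto simp: V_def)
      moreover have "(a, b) \<in> F \<inter> V y \<times> V y \<union> F \<inter> V z \<times> V z" if ab: "(a, b) \<in> F" for a b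
        using cover[of b] ab FK by (auto simp: V_def intro: converse_rtrancl_into_rtrancl)
      then have "F = F \<inter> V y \<times> V y \<union> F \<inter> V z \<times> V z" by auto
      ultimately show ?thesis by (simp add: digraph_of_def union_def T_def)
    qed
    moreover have "spanning (digraph_of K F) ?G"
      using F(1) FK by (simp add: spanning_def subgraph_rate_digraph) (simp add: rate_digraph_def)
    ultimately show "digraph_of K F \<in> ?L"
      using T unfolding two_tree_forests_def
      by (intro CollectI exI[of _ "T y"] exI[of _ "T z"] exI[of _ z]) (auto simp: T_def)
  qed
qed

lemma sum_arc_weight_digraph_of:
  "(\<Sum>T\<in>digraph_of K ` R. arc_weight k T) = (\<Sum>F\<in>R. rel_weight k F)"
  by (subst sum.reindex) (auto simp: inj_on_def digraph_of_def arc_weight_def rel_weight_def)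

text \<open>
  In a forest with one root every vertex leads to it, so the starting vertex \<open>x\<close> is arbitrary.
\<close>

lemma tree_weight_eq:
  assumes "finite K" "x \<in> K" "y \<in> K"
  shows "tree_weight K k y = forest_sum K (arcs (rate_digraph K k)) k 1 x y"
proof -
  let ?A = "arcs (rate_digraph K k)"
  have "finite ?A"
    using assms(1) by (rule finite_arcs_rate_digraph)
  have "leads_to_root F x y" if F: "F \<in> rooted_forests K ?A 1" "y \<notin> Domain F" for F
  proof -
    have "digraph_of K F \<in> spanning_trees_at (rate_digraph K k) y"
      using that assms by (simp add: spanning_trees_at_rate_digraph)
    then have "rooted_tree (rate_digraph K k) y (digraph_of K F)"
      by (simp add: spanning_trees_at_def)
    then show ?thesis
      using assms F \<open>finite ?A\<close> rtrancl_unique_root[of F K y x]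
      by (simp add: rooted_tree_rate_digraph leads_to_root_def rooted_forests_def finite_subset)
  qed
  then have "{F \<in> rooted_forests K ?A 1. y \<notin> Domain F} =
      {F \<in> rooted_forests K ?A 1. leads_to_root F x y}"
    by (auto simp: leads_to_root_def)
  then show ?thesis
    using assms \<open>finite ?A\<close>
    by (simp add: tree_weight_def spanning_trees_at_rate_digraph sum_arc_weight_digraph_of
        forest_sum_filter)
qed

lemma forest_weight_eq:
  assumes "finite K" "x \<in> K" "y \<in> K"
  shows "forest_weight K k x y = forest_sum K (arcs (rate_digraph K k)) k 2 x y"
proof -
  have "finite (arcs (rate_digraph K k))"
    using assms(1) by (rule finite_arcs_rate_digraph)
  then show ?thesis
    using assms by (simp add: forest_weight_def two_tree_forests_rate_digraph
        sum_arc_weight_digraph_of forest_sum_filter)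
qed

lemma total_tree_weight_eq:
  assumes "finite K" "K \<noteq> {}"
  shows "total_tree_weight K k = total_forest_sum K (arcs (rate_digraph K k)) k 1"
proof -
  obtain x where x: "x \<in> K" using assms(2) by blast
  then have "total_tree_weight K k = (\<Sum>y\<in>K. forest_sum K (arcs (rate_digraph K k)) k 1 x y)"
    unfolding total_tree_weight_def using assms(1) by (intro sum.cong tree_weight_eq refl)
  also have "\<dots> = total_forest_sum K (arcs (rate_digraph K k)) k 1"
    using assms(1) arcs_rate_digraph_subset x by (rule forest_sum_row)
  finally show ?thesis .
qed


section \<open>Irreducibility\<close>

lemma generator_arcs:
  assumes "finite K" "\<And>x y. x \<in> K \<Longrightarrow> y \<in> K \<Longrightarrow> x \<noteq> y \<Longrightarrow> 0 \<le> k x y" "x \<in> K"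
  shows "generator K k h x = (\<Sum>u\<in>arcs (rate_digraph K k) `` {x}. k x u * (h u - h x))"
proof -
  have "k x u * (h u - h x) = 0" if "u \<in> K - arcs (rate_digraph K k) `` {x}" for u
  proof (cases "u = x")
    case False
    with that assms(3) assms(2)[of x u] have "k x u = 0"
      by (auto simp: rate_digraph_def)
    then show ?thesis by simp
  qed simp
  moreover have "arcs (rate_digraph K k) `` {x} \<subseteq> K"
    using arcs_rate_digraph_subset[of K k] by blast
  ultimately show ?thesis
    unfolding generator_def using assms(1) by (intro sum.mono_neutral_right) auto
qed

lemma irreducible_rates_rtrancl:
  assumes "irreducible_rates K k" "x \<in> K" "y \<in> K"
  shows "(x, y) \<in> (arcs (rate_digraph K k))\<^sup>*"
proof -
  have "x \<rightarrow>\<^sup>*\<^bsub>rate_digraph K k\<^esub> y"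
    using assms by (auto simp: irreducible_rates_def strongly_connected_def rate_digraph_def)
  then have "(x, y) \<in> (arcs_ends (rate_digraph K k))\<^sup>*"
    by (rule reachable_rtranclI)
  then show ?thesis
    by (subst (asm) rate_digraph_eq) simp
qed

text \<open>
  Maximum principle: at a maximum of \<open>h\<close> the generator is a sum of nonpositive terms, so \<open>h\<close> has the
  same value at all out-neighbours; irreducibility spreads it over \<open>K\<close>.
\<close>

lemma harmonic_constant:
  assumes fin: "finite K" and nonneg: "\<And>x y. x \<in> K \<Longrightarrow> y \<in> K \<Longrightarrow> x \<noteq> y \<Longrightarrow> 0 \<le> k x y"
    and irr: "irreducible_rates K k" and harm: "\<And>x. x \<in> K \<Longrightarrow> generator K k h x = 0"
  obtains c where "\<And>x. x \<in> K \<Longrightarrow> h x = c"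
proof -
  let ?A = "arcs (rate_digraph K k)"
  have "K \<noteq> {}"
    using irr by (auto simp: irreducible_rates_def strongly_connected_def rate_digraph_def)
  then have "Max (h ` K) \<in> h ` K"
    using fin by simp
  then obtain m where "m \<in> K" and Max: "h m = Max (h ` K)"
    by (metis imageE)
  have m: "h x \<le> h m" if "x \<in> K" for x
    unfolding Max using fin that by simp
  have step: "h u = h m" if "h v = h m" "(v, u) \<in> ?A" for u v
  proof -
    have v: "v \<in> K" using that(2) by (simp add: rate_digraph_def)
    have pos: "0 < k v u'" "u' \<in> K" if "(v, u') \<in> ?A" for u'
      using that by (auto simp: rate_digraph_def)
    have nn: "0 \<le> k v u * (h m - h u)" if "u \<in> ?A `` {v}" for u
      using pos[of u] m[of u] that by simp
    have "(\<Sum>u\<in>?A `` {v}. k v u * (h m - h u)) = - generator K k h v"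
      using fin nonneg v \<open>h v = h m\<close>
      by (simp add: generator_arcs sum_negf[symmetric] algebra_simps)
    also have "\<dots> = 0" using harm[OF v] by simp
    finally have "\<forall>u\<in>?A `` {v}. k v u * (h m - h u) = 0"
      using nn finite_Image[OF finite_arcs_rate_digraph[OF fin]]
      by (subst (asm) sum_nonneg_eq_0_iff) auto
    then have "k v u * (h m - h u) = 0" using that(2) by blast
    with pos(1)[OF that(2)] show ?thesis by simp
  qed
  have "h x = h m" if "x \<in> K" for x
    using irreducible_rates_rtrancl[OF irr \<open>m \<in> K\<close> that]
    by (induction rule: rtrancl_induct) (auto intro: step)
  then show thesis by (rule that)
qed

text \<open>
  Every vertex other than \<open>r\<close> gets an arc that brings it closer to \<open>r\<close>; the decreasing distance
  excludes cycles.
\<close>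

lemma ex_spanning_tree:
  assumes "finite K" "A \<subseteq> K \<times> K" "r \<in> K" "\<And>x. x \<in> K \<Longrightarrow> (x, r) \<in> A\<^sup>*"
  shows "rooted_forests K A 1 \<noteq> {}"
proof -
  define d where "d x = (LEAST n. (x, r) \<in> A ^^ n)" for x
  have "\<exists>u. (x, u) \<in> A \<and> d u < d x" if x: "x \<in> K - {r}" for x
  proof -
    obtain n where "(x, r) \<in> A ^^ n"
      using rtrancl_imp_relpow[OF assms(4)[of x]] x by auto
    then have d: "(x, r) \<in> A ^^ d x"
      unfolding d_def by (rule LeastI)
    then obtain m where m: "d x = Suc m"
      using x by (cases "d x") auto
    obtain u where u: "(x, u) \<in> A" "(u, r) \<in> A ^^ m"
      using d unfolding m by (rule relpow_Suc_E2)
    have "d u \<le> m" unfolding d_def using u(2) by (rule Least_le)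
    with u(1) m show ?thesis by auto
  qed
  then obtain p where "\<And>x. x \<in> K - {r} \<Longrightarrow> (x, p x) \<in> A \<and> d (p x) < d x"
    by metis
  then have p: "(x, p x) \<in> A" "d (p x) < d x" if "x \<in> K" "x \<noteq> r" for x
    using that by simp_all
  define F where "F = (\<lambda>x. (x, p x)) ` (K - {r})"
  have "F\<inverse> \<subseteq> measure d" by (auto simp: F_def intro: p)
  then have "acyclic (F\<inverse>)"
    using wf_subset[OF wf_measure] wf_acyclic by blast
  then have "acyclic F" by simp
  moreover have "card F + 1 = card K"
    using card.remove[OF assms(1,3)] by (simp add: F_def card_image inj_on_def)
  moreover have "F \<subseteq> A" "single_valued F"
    by (auto simp: F_def single_valued_def intro: p)
  ultimately show ?thesis by (auto simp: rooted_forests_def)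
qed

lemma total_tree_weight_pos:
  assumes "finite K" "irreducible_rates K k"
  shows "0 < total_tree_weight K k"
proof -
  let ?A = "arcs (rate_digraph K k)"
  have "K \<noteq> {}"
    using assms(2) by (auto simp: irreducible_rates_def strongly_connected_def rate_digraph_def)
  then obtain r where "r \<in> K" by blast
  then have "rooted_forests K ?A 1 \<noteq> {}"
    using assms arcs_rate_digraph_subset irreducible_rates_rtrancl
    by (intro ex_spanning_tree[of K ?A r]) auto
  moreover have "0 < rel_weight k F" if "F \<in> rooted_forests K ?A 1" for F
    using that unfolding rel_weight_def
    by (intro prod_pos) (auto simp: rooted_forests_def rate_digraph_def)
  ultimately show ?thesis
    unfolding total_tree_weight_eq[OF assms(1) \<open>K \<noteq> {}\<close>] total_forest_sum_def
    by (intro sum_pos finite_rooted_forests finite_arcs_rate_digraph assms(1))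
qed


section \<open>The forest representation of the solution\<close>

theorem mainTheorem1:
  fixes K :: "'a set" and k :: "'a \<Rightarrow> 'a \<Rightarrow> real" and \<rho> f :: "'a \<Rightarrow> real"
  assumes "finite K"
    and "\<And>x y. x \<in> K \<Longrightarrow> y \<in> K \<Longrightarrow> x \<noteq> y \<Longrightarrow> 0 \<le> k x y"
    and "irreducible_rates K k"
    and "stationary_distribution K k \<rho>"
    and "(\<Sum>x\<in>K. \<rho> x * f x) = 0"
  shows "centered_poisson_solution K k \<rho> f
           (\<lambda>x. \<Sum>y\<in>K. forest_weight K k x y / total_tree_weight K k * f y)
         \<and> (\<forall>V. centered_poisson_solution K k \<rho> f V \<longrightarrow>
              (\<forall>x\<in>K. V x = (\<Sum>y\<in>K. forest_weight K k x y / total_tree_weight K k * f y)))"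
proof -
  let ?A = "arcs (rate_digraph K k)"
  define N where "N j = forest_sum K ?A k j" for j
  define W where "W j = total_forest_sum K ?A k j" for j
  define V where "V x = (\<Sum>y\<in>K. N 2 x y / W 1 * f y)" for x
  have \<rho>: "(\<Sum>x\<in>K. \<rho> x) = 1" "\<And>h. (\<Sum>x\<in>K. \<rho> x * generator K k h x) = 0"
    using assms(4) by (simp_all add: stationary_distribution_def)
  have "K \<noteq> {}" using \<rho>(1) by auto
  have W: "total_tree_weight K k = W 1" "W 1 \<noteq> 0"
    using total_tree_weight_eq[OF assms(1) \<open>K \<noteq> {}\<close>] total_tree_weight_pos[OF assms(1,3)]
    by (simp_all add: W_def)
  have gen_N: "generator K k (\<lambda>u. N (Suc j) u y) x = N j x y - of_bool (x = y) * W j"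
    if "x \<in> K" for j x y
    using assms(1,2) that
    by (simp add: generator_arcs N_def W_def forest_sum_backward finite_arcs_rate_digraph)
  \<comment> \<open>Stationarity annihilates the generator side of \<open>gen_N\<close>.\<close>
  have \<rho>_N: "(\<Sum>x\<in>K. \<rho> x * N j x y) = W j * \<rho> y" if "y \<in> K" for j y
  proof -
    have "0 = (\<Sum>x\<in>K. \<rho> x * (N j x y - of_bool (x = y) * W j))"
      using \<rho>(2)[of "\<lambda>u. N (Suc j) u y"] gen_N by simp
    also have "\<dots> = (\<Sum>x\<in>K. \<rho> x * N j x y) - (\<Sum>x\<in>K. if x = y then \<rho> x * W j else 0)"
      unfolding sum_subtractf[symmetric] by (rule sum.cong) (auto simp: algebra_simps)
    finally show ?thesis using assms(1) that by simp
  qed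
  have N_1: "N 1 x y = W 1 * \<rho> y" if "x \<in> K" "y \<in> K" for x y
  proof -
    have "N 1 z y = N 1 x y" if "z \<in> K" for z
      using tree_weight_eq[OF assms(1), of _ y k] \<open>x \<in> K\<close> \<open>y \<in> K\<close> that
      by (metis N_def)
    then have "(\<Sum>z\<in>K. \<rho> z * N 1 z y) = N 1 x y"
      using \<rho>(1) by (simp add: sum_distrib_right[symmetric])
    with \<rho>_N[OF that(2), of 1] show ?thesis by simp
  qed
  have poisson: "generator K k V x + f x = 0" if x: "x \<in> K" for x
  proof -
    have "generator K k V x = (\<Sum>u\<in>K. \<Sum>y\<in>K. f y / W 1 * (k x u * (N 2 u y - N 2 x y)))"
      by (simp add: generator_def V_def sum_distrib_left sum_subtractf[symmetric] algebra_simps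
          diff_divide_distrib)
    also have "\<dots> = (\<Sum>y\<in>K. f y / W 1 * generator K k (\<lambda>u. N 2 u y) x)"
      unfolding generator_def sum_distrib_left by (rule sum.swap)
    also have "\<dots> = (\<Sum>y\<in>K. f y / W 1 * (W 1 * \<rho> y - of_bool (x = y) * W 1))"
      using gen_N[OF x, of 1] N_1[OF x] by (simp add: numeral_2_eq_2)
    also have "\<dots> = (\<Sum>y\<in>K. \<rho> y * f y) - (\<Sum>y\<in>K. if x = y then f y else 0)"
      unfolding sum_subtractf[symmetric] using W(2)
      by (intro sum.cong) (auto simp: field_simps)
    also have "\<dots> = - f x" using assms(1,5) x by simp
    finally show ?thesis by simp
  qed
  have centered: "(\<Sum>x\<in>K. \<rho> x * V x) = 0"
  proof -
    have "(\<Sum>x\<in>K. \<rho> x * V x) = (\<Sum>x\<in>K. \<Sum>y\<in>K. f y / W 1 * (\<rho> x * N 2 x y))"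
      by (simp add: V_def sum_distrib_left algebra_simps)
    also have "\<dots> = (\<Sum>y\<in>K. f y / W 1 * (\<Sum>x\<in>K. \<rho> x * N 2 x y))"
      unfolding sum_distrib_left by (rule sum.swap)
    also have "\<dots> = (\<Sum>y\<in>K. W 2 / W 1 * (\<rho> y * f y))"
      using \<rho>_N[of _ 2] by (intro sum.cong) auto
    also have "\<dots> = W 2 / W 1 * (\<Sum>y\<in>K. \<rho> y * f y)"
      by (rule sum_distrib_left[symmetric])
    also have "\<dots> = 0" using assms(5) by simp
    finally show ?thesis .
  qed
  have unique: "U x = V x" if U: "centered_poisson_solution K k \<rho> f U" and x: "x \<in> K" for U x
  proof -
    have "generator K k (\<lambda>x. U x - V x) z = 0" if z: "z \<in> K" for z
    proof -
      have "generator K k (\<lambda>x. U x - V x) z = generator K k U z - generator K k V z"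
        by (simp add: generator_def sum_subtractf[symmetric] algebra_simps)
      moreover have "generator K k U z + f z = 0"
        using U z by (simp add: centered_poisson_solution_def)
      ultimately show ?thesis using poisson[OF z] by simp
    qed
    then obtain c where c: "\<And>z. z \<in> K \<Longrightarrow> U z - V z = c"
      using harmonic_constant[OF assms(1-3), of "\<lambda>x. U x - V x"] by blast
    have "c = (\<Sum>z\<in>K. \<rho> z * (U z - V z))"
      using \<rho>(1) c by (simp add: sum_distrib_right[symmetric])
    also have "\<dots> = 0"
      using U centered by (simp add: centered_poisson_solution_def right_diff_distrib sum_subtractf)
    finally show ?thesis using c[OF x] by simp
  qed
  have V: "V x = (\<Sum>y\<in>K. forest_weight K k x y / total_tree_weight K k * f y)" if "x \<in> K" for x
    using assms(1) that by (simp add: V_def W(1) N_def forest_weight_eq)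
  have "generator K k (\<lambda>x. \<Sum>y\<in>K. forest_weight K k x y / total_tree_weight K k * f y) x =
      generator K k V x" if "x \<in> K" for x
    using that by (simp add: generator_def V)
  then show ?thesis
    using poisson centered unique by (simp add: centered_poisson_solution_def V)
qed

end
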